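(* Let $f(x)\in\mathbf{Z}[x]$ be a nonconstant separable polynomial and let $p$ be a good prime for $f(x)$. (1) If $f(x)$ has odd degree, then there are infinitely many $d\in\mathcal{S}(f)$ such that $p\mid d$. (2) Suppose $f(x)$ has even degree. (a) If there exists $d\in\mathcal{S}(f)$ such that $p\mid d$, then $f(x)$ has a root modulo $p$. (b) Conversely, if $f(x)$ has a root modulo $p$, then there are infinitely many $d\in\mathcal{S}(f)$ such that $p\mid d$.
   Context: Squarefree integers may be negative and are nonzero. For a nonzero rational number $r$, its squarefree part $S(r)$ is the unique squarefree integer $d$ such that $r/d$ is a square in $\mathbf{Q}$. For a separable nonconstant $f(x)\in\mathbf{Z}[x]$, $\mathcal{S}(f)=\{S(f(r)) : r\in\mathbf{Q},\ f(r)\neq 0\}$. An odd prime $p$ is good for $f(x)$ if the reduced polynomial $\bar f(x)\in\mathbf{F}_p[x]$ has the same degree as $f(x)$ and has nonzero discriminant. *)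

theory Defs
  imports
    "HOL-Computational_Algebra.Computational_Algebra"
    "Berlekamp_Zassenhaus.Finite_Field"
    "Subresultants.Resultant_Prelim"
begin

(* In the library, squarefree is a predicate on all of int: negative squarefree integers are
   allowed and 0 is not squarefree. The constant squarefree_part of HOL-Computational_Algebra
   only applies to integers, hence the separate notion for rationals. The value at 0 is
   unspecified. *)
definition rat_squarefree_part :: "rat \<Rightarrow> int" where
  "rat_squarefree_part r = (THE d. squarefree d \<and> (\<exists>s::rat. r / of_int d = s ^ 2))"

lemma rat_squarefree_part_ex1:
  fixes r :: rat
  assumes "r \<noteq> 0"
  shows "\<exists>!d::int. squarefree d \<and> (\<exists>s::rat. r / of_int d = s ^ 2)"
proof (rule ex_ex1I)
  obtain a b where q: "quotient_of r = (a, b)" by (cases "quotient_of r")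
  have b: "b > 0" using q by (rule quotient_of_denom_pos)
  have r: "r = of_int a / of_int b" using q by (rule quotient_of_div)
  define d where "d = squarefree_part (a * b)"
  define s where "s = square_part (a * b)"
  have "a * b = d * s ^ 2" unfolding d_def s_def by (rule squarefree_decompose)
  hence "(of_int a * of_int b :: rat) = of_int d * of_int s ^ 2"
    by (metis of_int_mult of_int_power)
  moreover have "d \<noteq> 0" by (simp add: d_def)
  ultimately have "r / of_int d = (of_int s / of_int b) ^ 2"
    using b unfolding r by (simp add: field_simps power2_eq_square)
  thus "\<exists>d::int. squarefree d \<and> (\<exists>s::rat. r / of_int d = s ^ 2)"
    by (intro exI[of _ d]) (auto simp: d_def)
next
  fix d e :: int
  assume d: "squarefree d \<and> (\<exists>s::rat. r / of_int d = s ^ 2)"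
     and e: "squarefree e \<and> (\<exists>s::rat. r / of_int e = s ^ 2)"
  then obtain s t :: rat where s: "r / of_int d = s ^ 2" and t: "r / of_int e = t ^ 2" by blast
  have d0: "d \<noteq> 0" "e \<noteq> 0" using d e by auto
  have st0: "s \<noteq> 0" "t \<noteq> 0" using s t d0 assms by auto
  have eq: "of_int d * s ^ 2 = of_int e * t ^ 2"
    using s t d0 by (metis nonzero_mult_div_cancel_left of_int_eq_0_iff times_divide_eq_right)
  obtain a b where q: "quotient_of s = (a, b)" by (cases "quotient_of s")
  obtain a' b' where q': "quotient_of t = (a', b')" by (cases "quotient_of t")
  have b: "b > 0" "b' > 0" using q q' by (auto intro: quotient_of_denom_pos)
  have sr: "s = of_int a / of_int b" "t = of_int a' / of_int b'"
    using q q' by (auto intro: quotient_of_div)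
  have "of_int d * (of_int a * of_int b') ^ 2 = (of_int e * (of_int a' * of_int b) ^ 2 :: rat)"
    using eq b unfolding sr by (simp add: field_simps)
  hence "of_int (d * (a * b') ^ 2) = (of_int (e * (a' * b) ^ 2) :: rat)" by simp
  hence main: "d * (a * b') ^ 2 = e * (a' * b) ^ 2" by (simp only: of_int_eq_iff)
  have nz: "a * b' \<noteq> 0" "a' * b \<noteq> 0" using st0 sr b by auto
  have dvd: "y dvd x" if h: "squarefree c" "y ^ 2 dvd c * x ^ 2" "x \<noteq> 0" for c x y :: int
  proof -
    obtain x' y' where xy: "x = x' * gcd x y" "y = y' * gcd x y" "coprime x' y'"
      using gcd_coprime_exists[of x y] h(3) by auto
    define g where "g = gcd x y"
    have "g \<noteq> 0" using h(3) by (simp add: g_def)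
    moreover have "(y' * g) ^ 2 dvd c * (x' * g) ^ 2"
      using h(2) xy(1,2) unfolding g_def by metis
    ultimately have "y' ^ 2 dvd c * x' ^ 2" by (simp add: power_mult_distrib mult.assoc [symmetric])
    moreover have "coprime (y' ^ 2) (x' ^ 2)" using xy(3) by (simp add: coprime_commute)
    ultimately have "y' ^ 2 dvd c" by (simp add: coprime_dvd_mult_left_iff)
    hence "y' dvd 1" by (rule squarefreeD[OF h(1)])
    hence "y' * g dvd 1 * g" by (rule mult_dvd_mono) simp
    thus ?thesis using xy(2) unfolding g_def by (metis dvd_trans gcd_dvd1 mult_1)
  qed
  have "a' * b dvd a * b'" by (rule dvd[of d]) (use d nz main in auto)
  moreover have "a * b' dvd a' * b" by (rule dvd[of e]) (use e nz main[symmetric] in auto)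
  ultimately have "\<bar>a * b'\<bar> = \<bar>a' * b\<bar>" using zdvd_antisym_abs by metis
  hence "(a * b') ^ 2 = (a' * b) ^ 2" by (metis power2_abs)
  thus "d = e" using main nz by simp
qed

definition squarefree_values :: "int poly \<Rightarrow> int set" where
  "squarefree_values f =
     {rat_squarefree_part (poly (map_poly of_int f) r) | r :: rat. poly (map_poly of_int f) r \<noteq> 0}"

(* No repeated roots in an algebraically closed field containing the rationals. *)
definition separable_int_poly :: "int poly \<Rightarrow> bool" where
  "separable_int_poly f \<longleftrightarrow> rsquarefree (map_poly of_int f :: complex poly)"

(* The derivative is treated as having formal degree n - 1: in positive characteristic its
   actual degree may be smaller, and the Sylvester determinant depends on this. *)
definition discriminant :: "'a::field poly \<Rightarrow> 'a" where
  "discriminant g = (let n = degree g in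
     (-1) ^ (n * (n - 1) div 2) * resultant_sub n (n - 1) g (pderiv g) / lead_coeff g)"

(* The prime is p = CARD('p), and 'p mod_ring is the field F_p; the sort prime_card makes
   CARD('p) prime. *)
definition good_prime :: "'p::prime_card itself \<Rightarrow> int poly \<Rightarrow> bool" where
  "good_prime _ f \<longleftrightarrow> odd (CARD('p)) \<and>
     degree (map_poly of_int f :: 'p mod_ring poly) = degree f \<and>
     discriminant (map_poly of_int f :: 'p mod_ring poly) \<noteq> 0"

definition has_root_mod :: "int poly \<Rightarrow> nat \<Rightarrow> bool" where
  "has_root_mod f p \<longleftrightarrow> (\<exists>a::int. [poly f a = 0] (mod int p))"

end

theory Submission
  imports Defs "HOL-Computational_Algebra.Field_as_Ring"
begin

text \<open>
  A prime divides the squarefree part of a rational number iff its valuation there is odd. At a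
  fraction with denominator divisible by \<open>p\<close> the valuation of \<open>f\<close> is determined by the leading term:
  it is odd for suitable fractions if the degree is odd, and always even if the degree is even. At
  a \<open>p\<close>-integral argument an odd valuation forces a root modulo \<open>p\<close>; conversely such a root is
  simple because \<open>p\<close> is good, so it can be moved to a point of valuation exactly 1.
  Each choice persists on a residue class. Infinitely many primes \<open>q\<close> divide values of \<open>f\<close>, all but
  finitely many of them only at simple roots modulo \<open>q\<close>, so by the Chinese remainder theorem the
  valuation at \<open>q\<close> can be made 1 inside the residue class. Hence the squarefree parts
  acquire arbitrarily large prime divisors.
\<close>

hide_const (open) up_ring.coeff module.smult

section \<open>Squarefree parts and parity of valuations\<close>

text \<open>With \<open>d\<close> the squarefree part and \<open>s = u / v\<close>, clearing
  denominators gives \<open>A * v ^ 2 = d * u ^ 2 * B\<close>, and \<open>d\<close> has valuation 0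
  or 1 at \<open>p\<close>. Only parity matters, so the two valuations may be added, and
  \<open>A / B\<close> need not be in lowest terms.\<close>

lemma prime_dvd_rat_squarefree_part_iff:
  fixes A B p :: int
  assumes "A \<noteq> 0" "B \<noteq> 0" "prime p"
  shows "p dvd rat_squarefree_part (of_int A / of_int B) \<longleftrightarrow> odd (multiplicity p A + multiplicity p B)"
proof -
  define d where "d = rat_squarefree_part (of_int A / of_int B)"
  have "(of_int A / of_int B :: rat) \<noteq> 0" using assms by simp
  from theI'[OF rat_squarefree_part_ex1[OF this]]
  have sq: "squarefree d" and ex: "\<exists>s::rat. of_int A / of_int B / of_int d = s ^ 2"
    unfolding d_def rat_squarefree_part_def by auto
  from ex obtain s :: rat where s: "of_int A / of_int B / of_int d = s ^ 2" by blast
  have d0: "d \<noteq> 0" using sq by auto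
  obtain u v where q: "quotient_of s = (u, v)" by (cases "quotient_of s")
  have v: "v > 0" using q by (rule quotient_of_denom_pos)
  have su: "s = of_int u / of_int v" using q by (rule quotient_of_div)
  have "of_int (A * v ^ 2) = (of_int (d * u ^ 2 * B) :: rat)"
    using s v d0 assms(1,2) unfolding su by (simp add: field_simps)
  hence eq: "A * v ^ 2 = d * u ^ 2 * B" by (simp only: of_int_eq_iff)
  have u0: "u \<noteq> 0" using eq assms v by auto
  have pe: "prime_elem p" using assms(3) by (rule prime_imp_prime_elem)
  have "multiplicity p A + 2 * multiplicity p v = multiplicity p (A * v ^ 2)"
    using assms v pe by (simp add: prime_elem_multiplicity_mult_distrib prime_elem_multiplicity_power_distrib)
  also have "\<dots> = multiplicity p d + 2 * multiplicity p u + multiplicity p B"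
    unfolding eq using assms d0 u0 pe
    by (simp add: prime_elem_multiplicity_mult_distrib prime_elem_multiplicity_power_distrib)
  finally have m: "multiplicity p A + 2 * multiplicity p v = \<dots>" .
  have "odd (multiplicity p A + multiplicity p B) \<longleftrightarrow> odd (multiplicity p d)"
    using m by presburger
  also have "\<dots> \<longleftrightarrow> p dvd d"
  proof (cases "p dvd d")
    case True
    have "\<not> p ^ 2 dvd d"
      using squarefreeD[OF sq, of p] assms(3) not_prime_unit by blast
    hence "multiplicity p d = 1" using True by (intro multiplicity_eqI) (auto simp: power2_eq_square)
    thus ?thesis using True by simp
  next
    case False
    thus ?thesis by (simp add: not_dvd_imp_multiplicity_0)
  qed
  finally show ?thesis unfolding d_def by simp
qed

lemma rat_squarefree_part_nonzero:
  assumes "r \<noteq> 0"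
  shows "rat_squarefree_part r \<noteq> 0"
  using theI'[OF rat_squarefree_part_ex1[OF assms]]
  unfolding rat_squarefree_part_def by auto

lemma multiplicity_eq_1I:
  fixes p x :: "'a :: factorial_semiring"
  assumes "p dvd x" "\<not> p ^ 2 dvd x"
  shows "multiplicity p x = 1"
  using assms by (intro multiplicity_eqI) (auto simp: power2_eq_square)

section \<open>Values at fractions through binary forms\<close>

text \<open>The binary form \<open>y ^ n * f (x / y)\<close> with \<open>n = degree f\<close>,
  written without division so that it makes sense over the integers.\<close>

definition homogenization :: "'a::comm_semiring_1 poly \<Rightarrow> 'a \<Rightarrow> 'a \<Rightarrow> 'a" where
  "homogenization f x y = (\<Sum>i\<le>degree f. coeff f i * x ^ i * y ^ (degree f - i))"

lemma homogenization_1 [simp]: "homogenization f x 1 = poly f x"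
  by (simp add: homogenization_def poly_altdef)

text \<open>Serves to compare a numerator over a fixed denominator \<open>y\<close> with an ordinary
  value of \<open>f\<close>, modulo anything prime to \<open>y\<close>.\<close>

lemma homogenization_scale:
  "homogenization f (y * x) y = y ^ degree f * poly f x"
proof -
  have "coeff f i * (y * x) ^ i * y ^ (degree f - i) = y ^ degree f * (coeff f i * x ^ i)"
    if "i \<le> degree f" for i
  proof -
    have "y ^ degree f = y ^ i * y ^ (degree f - i)" using that by (simp flip: power_add)
    thus ?thesis by (simp add: power_mult_distrib mult_ac)
  qed
  thus ?thesis by (simp add: homogenization_def poly_altdef sum_distrib_left)
qed

lemma poly_of_int_fraction:
  fixes f :: "int poly" and x y :: int
  assumes "y \<noteq> 0"
  shows "poly (map_poly of_int f) (of_int x / of_int y) =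
    (of_int (homogenization f x y) / of_int (y ^ degree f) :: rat)"
proof -
  have "of_int (coeff f i * x ^ i * y ^ (degree f - i)) / of_int (y ^ degree f) =
      (of_int (coeff f i) * (of_int x / of_int y) ^ i :: rat)" if "i \<le> degree f" for i
  proof -
    have "y ^ degree f = y ^ (degree f - i) * y ^ i" using that by (simp flip: power_add)
    thus ?thesis using assms by (simp add: power_divide)
  qed
  thus ?thesis
    by (simp add: homogenization_def poly_altdef sum_divide_distrib)
qed

lemma homogenization_cong:
  fixes f :: "int poly"
  assumes "[x = x'] (mod m)"
  shows "[homogenization f x y = homogenization f x' y] (mod m)"
  unfolding homogenization_def
  by (intro cong_sum cong_mult cong_pow cong_refl assms)

text \<open>Every term except the top one carries a factor \<open>y\<close>. So if \<open>p\<close>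
  divides \<open>y\<close> but neither \<open>x\<close> nor the leading coefficient, the numerator
  is prime to \<open>p\<close>.\<close>

lemma homogenization_cong_lead:
  fixes f :: "int poly"
  assumes "p dvd y"
  shows "[homogenization f x y = lead_coeff f * x ^ degree f] (mod p)"
proof -
  have "homogenization f x y =
      (\<Sum>i<degree f. coeff f i * x ^ i * y ^ (degree f - i)) + lead_coeff f * x ^ degree f"
    unfolding homogenization_def by (simp add: lessThan_Suc_atMost [symmetric])
  moreover have "p dvd (\<Sum>i<degree f. coeff f i * x ^ i * y ^ (degree f - i))"
    using assms by (intro dvd_sum dvd_mult dvd_power_le[of p y 1, simplified]) auto
  ultimately show ?thesis by (simp add: cong_iff_dvd_diff)
qed

lemma poly_int_cong:
  fixes f :: "int poly"
  assumes "[x = y] (mod m)"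
  shows "[poly f x = poly f y] (mod m)"
  unfolding poly_altdef by (intro cong_sum cong_mult cong_pow cong_refl assms)

section \<open>Taylor expansion and simple roots modulo a prime\<close>

lemma poly_taylor_dvd:
  fixes f :: "'a::idom poly"
  shows "h ^ 2 dvd poly f (x + h) - poly f x - h * poly (pderiv f) x"
proof (induction f)
  case (pCons a f)
  then obtain k where k: "poly f (x + h) - poly f x - h * poly (pderiv f) x = h ^ 2 * k" by blast
  have "poly (pCons a f) (x + h) - poly (pCons a f) x - h * poly (pderiv (pCons a f)) x
      = (x + h) * (poly f (x + h) - poly f x - h * poly (pderiv f) x) + h ^ 2 * poly (pderiv f) x"
    by (simp add: pderiv_pCons algebra_simps power2_eq_square)
  also have "\<dots> = h ^ 2 * ((x + h) * k + poly (pderiv f) x)"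
    unfolding k by (simp add: algebra_simps)
  finally show ?case by simp
qed simp

text \<open>If \<open>x\<close> itself has valuation at least 2, the shift to \<open>x + q\<close>
  changes the value by \<open>q * poly (pderiv f) x\<close> modulo \<open>q ^ 2\<close>, which is
  not 0 there.\<close>

lemma simple_root_mod_exactly_dvd:
  fixes f :: "int poly"
  assumes "prime q" "q dvd poly f x" "\<not> q dvd poly (pderiv f) x"
  obtains y where "q dvd poly f y" "\<not> q ^ 2 dvd poly f y"
proof (cases "q ^ 2 dvd poly f x")
  case True
  let ?y = "x + q"
  have t: "q ^ 2 dvd poly f ?y - poly f x - q * poly (pderiv f) x" by (rule poly_taylor_dvd)
  have "q dvd poly f ?y"
  proof -
    have "[poly f ?y = poly f x] (mod q)" by (rule poly_int_cong) (simp add: cong_def)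
    thus ?thesis using assms(2) by (simp add: cong_dvd_iff)
  qed
  moreover have "\<not> q ^ 2 dvd poly f ?y"
  proof
    assume "q ^ 2 dvd poly f ?y"
    from dvd_diff[OF dvd_diff[OF this True] t] have "q ^ 2 dvd q * poly (pderiv f) x"
      by simp
    moreover have "q \<noteq> 0" using assms by auto
    ultimately show False using assms(3) by (simp add: power2_eq_square)
  qed
  ultimately show ?thesis by (rule that)
qed (use assms that in blast)

section \<open>Large prime divisors of polynomial values\<close>

lemma finite_poly_int_fibre:
  fixes f :: "int poly"
  assumes "degree f > 0"
  shows "finite {x. poly f x = c}"
proof -
  have "f - [:c:] \<noteq> 0" using assms by auto
  from poly_roots_finite[OF this] show ?thesis by simp
qed

text \<open>Euclid's argument: some value has the form \<open>c * (1 + K * h)\<close>, where every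
  prime up to \<open>N\<close> divides \<open>K\<close> and the second factor is not a unit.\<close>

lemma exists_large_prime_divisor_poly_value:
  fixes f :: "int poly" and N :: nat
  assumes "degree f > 0"
  obtains q x where "prime q" "q > int N" "q dvd poly f x"
proof -
  have "\<exists>x. poly f x \<noteq> 0"
  proof (rule ccontr)
    assume "\<not> ?thesis"
    hence "{x. poly f x = 0} = UNIV" by auto
    thus False using finite_poly_int_fibre[OF assms, of 0] by (simp add: infinite_UNIV_int)
  qed
  then obtain x0 where c0: "poly f x0 \<noteq> 0" by blast
  define c where "c = poly f x0"
  \<comment> \<open>Along \<open>x0 + c K t\<close> the values are \<open>c\<close> times numbers coprime to all primes up to \<open>N\<close>.\<close>
  define K :: int where "K = fact N"
  have K: "K \<noteq> 0" by (simp add: K_def)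
  define g where "g t = x0 + c * K * t" for t
  have "inj g" using c0 K by (auto simp: inj_def g_def c_def)
  hence "infinite (range g)" by (simp add: finite_image_iff infinite_UNIV_int)
  \<comment> \<open>Each of the finitely many values of size at most \<open>\<bar>c\<bar>\<close> is
    taken finitely often, so the progression contains a point with a larger value.\<close>
  moreover have "finite (\<Union>v\<in>{-\<bar>c\<bar>..\<bar>c\<bar>}. {x. poly f x = v})"
    using finite_poly_int_fibre[OF assms] by blast
  ultimately obtain t where "g t \<notin> (\<Union>v\<in>{-\<bar>c\<bar>..\<bar>c\<bar>}. {x. poly f x = v})"
    by (metis finite_subset image_subset_iff)
  hence big: "\<bar>poly f (g t)\<bar> > \<bar>c\<bar>" by auto
  have "[poly f (g t) = c] (mod c * K)"
    unfolding c_def by (rule poly_int_cong) (simp add: g_def c_def cong_iff_dvd_diff)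
  then obtain h where "poly f (g t) - c = c * K * h" by (auto simp: cong_iff_dvd_diff)
  hence h: "poly f (g t) = c * (1 + K * h)" by (simp add: algebra_simps)
  have "\<bar>1 + K * h\<bar> > 1"
  proof (rule ccontr)
    assume "\<not> ?thesis"
    hence "\<bar>c\<bar> * \<bar>1 + K * h\<bar> \<le> \<bar>c\<bar> * 1" by (intro mult_left_mono) auto
    thus False using big unfolding h by (simp add: abs_mult)
  qed
  hence "\<not> is_unit (1 + K * h)" "1 + K * h \<noteq> 0" by auto
  then obtain q where q: "prime q" "q dvd 1 + K * h" using prime_divisor_exists by blast
  have "q > int N"
  proof (rule ccontr)
    assume "\<not> ?thesis"
    moreover have "q > 0" using q(1) by (simp add: prime_gt_0_int)
    ultimately have "nat q dvd fact N" by (intro dvd_fact) auto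
    hence "int (nat q) dvd int (fact N)" by (simp only: int_dvd_int_iff)
    hence "q dvd K" using \<open>q > 0\<close> by (simp add: K_def of_nat_fact)
    hence "q dvd 1" using q(2) by (metis dvd_add_left_iff dvd_mult2)
    thus False using q(1) by auto
  qed
  moreover have "q dvd poly f (g t)" using q(2) h by simp
  ultimately show ?thesis using that q(1) by blast
qed

section \<open>Separability and primes with multiple roots\<close>

lemma clear_denominators_rat_poly:
  fixes q :: "rat poly"
  obtains c :: int and g :: "int poly" where "c \<noteq> 0" "map_poly of_int g = smult (of_int c) q"
proof (induction q arbitrary: thesis)
  case 0
  show ?case by (rule 0[of 1 0]) auto
next
  case (pCons a q)
  obtain c g where c: "c \<noteq> 0" "map_poly of_int g = smult (of_int c) q" using pCons.IH by blast
  obtain n d where nd: "quotient_of a = (n, d)" by (cases "quotient_of a")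
  have d: "d > 0" using nd by (rule quotient_of_denom_pos)
  have a: "a = of_int n / of_int d" using nd by (rule quotient_of_div)
  show ?case
  proof (rule pCons.prems)
    show "d * c \<noteq> 0" using d c by simp
    have "map_poly of_int (smult d g) = smult (of_int d) (map_poly of_int g :: rat poly)"
      by (intro poly_eqI) (simp add: coeff_map_poly)
    thus "map_poly of_int (pCons (n * c) (smult d g)) = smult (of_int (d * c)) (pCons a q)"
      using c d by (simp add: a of_int_hom.map_poly_pCons_hom)
  qed
qed

text \<open>A nonconstant common divisor over the rationals would have a complex root, which would
  be a multiple root of \<open>f\<close>.\<close>

lemma separable_int_poly_imp_coprime_rat:
  assumes "separable_int_poly f"
  shows "coprime (map_poly of_int f :: rat poly) (pderiv (map_poly of_int f))"
proof (rule coprimeI)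
  let ?F = "map_poly of_int f :: rat poly"
  let ?C = "map_poly of_rat :: rat poly \<Rightarrow> complex poly"
  fix d assume d: "d dvd ?F" "d dvd pderiv ?F"
  have C: "?C ?F = map_poly of_int f"
    by (intro poly_eqI) (simp add: coeff_map_poly)
  have C': "?C (pderiv ?F) = pderiv (?C ?F)"
    by (intro poly_eqI) (simp add: coeff_map_poly coeff_pderiv of_rat_mult of_rat_add)
  have hom: "?C (a * b) = ?C a * ?C b" for a b
    by (intro poly_eqI) (simp add: coeff_map_poly coeff_mult of_rat_sum of_rat_mult)
  have dvd: "?C d dvd ?C ?F" "?C d dvd pderiv (?C ?F)"
    using d unfolding C'[symmetric] by (auto elim!: dvdE simp: hom)
  have "?F \<noteq> 0"
  proof
    assume "?F = 0"
    hence "map_poly of_int f = (0 :: complex poly)" using C by simp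
    thus False using assms by (simp add: separable_int_poly_def rsquarefree_def)
  qed
  hence d0: "d \<noteq> 0" using d by auto
  have "degree (?C d) = 0"
  proof (rule ccontr)
    assume "degree (?C d) \<noteq> 0"
    then obtain z where "poly (?C d) z = 0"
      using fundamental_theorem_of_algebra[of "?C d"] by (auto simp: constant_degree)
    hence "poly (?C ?F) z = 0" "poly (pderiv (?C ?F)) z = 0"
      using dvd by (auto elim!: dvdE)
    thus False using assms unfolding separable_int_poly_def C[symmetric] rsquarefree_roots by blast
  qed
  moreover have "degree (?C d) = degree d" by (rule degree_map_poly) auto
  ultimately show "is_unit d" using d0 by (simp add: is_unit_iff_degree)
qed

text \<open>Clearing denominators in a Bezout identity for \<open>f\<close> and its derivative
  writes a fixed nonzero integer as a combination of their values at every \<open>x\<close>. Hence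
  only finitely many primes allow a multiple root.\<close>

lemma common_prime_divisors_poly_pderiv_bounded:
  assumes "separable_int_poly f"
  obtains c :: int where "c \<noteq> 0"
    "\<And>q x. q dvd poly f x \<Longrightarrow> q dvd poly (pderiv f) x \<Longrightarrow> q dvd c"
proof -
  let ?R = "map_poly of_int :: int poly \<Rightarrow> rat poly"
  obtain u v where uv: "u * ?R f + v * pderiv (?R f) = 1"
    using bezout_coefficients_fst_snd[of "?R f" "pderiv (?R f)"]
      separable_int_poly_imp_coprime_rat[OF assms] by (auto simp: coprime_iff_gcd_eq_1)
  obtain a U where U: "a \<noteq> 0" "?R U = smult (of_int a) u" by (rule clear_denominators_rat_poly)
  obtain b V where V: "b \<noteq> 0" "?R V = smult (of_int b) v" by (rule clear_denominators_rat_poly)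
  have P: "poly (?R g) (of_int x) = of_int (poly g x)" for g x
    by (simp add: poly_altdef)
  have D: "pderiv (?R f) = ?R (pderiv f)"
    by (intro poly_eqI) (simp add: coeff_map_poly coeff_pderiv)
  have "b * poly U x * poly f x + a * poly V x * poly (pderiv f) x = a * b" for x
  proof -
    have "of_int (b * poly U x * poly f x + a * poly V x * poly (pderiv f) x) =
       (of_int (a * b) * poly (u * ?R f + v * pderiv (?R f)) (of_int x) :: rat)"
      unfolding of_int_add of_int_mult P[symmetric] U V D by (simp add: algebra_simps)
    also have "\<dots> = of_int (a * b)" unfolding uv by simp
    finally show ?thesis by (simp only: of_int_eq_iff)
  qed
  hence "q dvd poly f x \<Longrightarrow> q dvd poly (pderiv f) x \<Longrightarrow> q dvd a * b" for q x
    using dvd_add dvd_mult by metis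
  moreover have "a * b \<noteq> 0" using U V by simp
  ultimately show ?thesis using that by blast
qed

text \<open>A prime divisor of a value that also exceeds \<open>\<bar>c\<bar>\<close> cannot divide
  \<open>c\<close>, so the root is simple and can be moved to valuation 1.\<close>

lemma exists_large_prime_exactly_dvd:
  fixes f :: "int poly" and N :: nat
  assumes "degree f > 0" "separable_int_poly f"
  obtains q x where "prime q" "q > int N" "q dvd poly f x" "\<not> q ^ 2 dvd poly f x"
proof -
  obtain c :: int where c: "c \<noteq> 0"
    "\<And>q x. q dvd poly f x \<Longrightarrow> q dvd poly (pderiv f) x \<Longrightarrow> q dvd c"
    using common_prime_divisors_poly_pderiv_bounded[OF assms(2)] by blast
  obtain q x where q: "prime q" "q > int (max N (nat \<bar>c\<bar>))" "q dvd poly f x"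
    by (rule exists_large_prime_divisor_poly_value[OF assms(1)])
  have "\<not> q dvd c" using zdvd_imp_le[of q "\<bar>c\<bar>"] c(1) q(2) by auto
  hence "\<not> q dvd poly (pderiv f) x" using c(2) q(3) by blast
  then obtain y where "q dvd poly f y" "\<not> q ^ 2 dvd poly f y"
    by (rule simple_root_mod_exactly_dvd[OF q(1,3)])
  moreover have "q > int N" using q(2) by linarith
  ultimately show ?thesis using that q(1) by blast
qed

section \<open>Infinitely many squarefree parts from one residue class\<close>

text \<open>The common engine of both infinitude claims: \<open>val\<close> secures divisibility by
  \<open>p\<close> on a whole residue class of numerators over \<open>k\<close>. This leaves room to
  impose divisibility by a new prime too large for any of a supposed finite set of squarefree
  parts.\<close>

lemma infinite_squarefree_values_in_residue_class:
  fixes f :: "int poly" and p k a M :: int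
  assumes "degree f > 0" "separable_int_poly f" "prime p" "k > 0" "M > 0"
    and val: "\<And>x. [x = a] (mod M) \<Longrightarrow>
      odd (multiplicity p (homogenization f x k) + multiplicity p (k ^ degree f))"
  shows "infinite {d \<in> squarefree_values f. p dvd d}"
proof
  assume fin: "finite {d \<in> squarefree_values f. p dvd d}" (is "finite ?D")
  \<comment> \<open>A prime beyond \<open>N\<close> divides neither \<open>M\<close> nor
    \<open>k\<close>, and exceeds every \<open>\<bar>d\<bar>\<close> with \<open>d\<close> in the
    finite set.\<close>
  define N where "N = nat (M + k + (\<Sum>d\<in>?D. \<bar>d\<bar>))"
  obtain q m where q: "prime q" "q > int N" "q dvd poly f m" "\<not> q ^ 2 dvd poly f m"
    by (rule exists_large_prime_exactly_dvd[OF assms(1,2)])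
  have sum0: "(\<Sum>d\<in>?D. \<bar>d\<bar>) \<ge> 0" by (intro sum_nonneg) auto
  have qgt: "q > M" "q > k" "q > (\<Sum>d\<in>?D. \<bar>d\<bar>)"
    using q(2) assms(4,5) sum0 unfolding N_def by linarith+
  have qk: "\<not> q dvd k" "\<not> q dvd M" using qgt assms(4,5) by (meson not_le zdvd_imp_le)+
  have "coprime (q ^ 2) M" using qk(2) q(1) by (simp add: prime_imp_coprime)
  \<comment> \<open>The first congruence makes \<open>x / k\<close> agree with \<open>m\<close>
    modulo \<open>q ^ 2\<close>, so valuation 1 at \<open>q\<close> carries over; the second keeps
    \<open>val\<close> applicable.\<close>
  then obtain x where x: "[x = k * m] (mod q ^ 2)" "[x = a] (mod M)"
    using binary_chinese_remainder_int by blast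
  define H where "H = homogenization f x k"
  have cH: "[H = k ^ degree f * poly f m] (mod q ^ 2)"
    unfolding H_def homogenization_scale[symmetric] by (rule homogenization_cong) (rule x)
  hence "[H = k ^ degree f * poly f m] (mod q)" by (rule cong_dvd_modulus) simp
  note H = cong_dvd_iff[OF cH] cong_dvd_iff[OF this]
  have "coprime (q ^ 2) (k ^ degree f)" using qk(1) q(1) by (simp add: prime_imp_coprime)
  hence "\<not> q ^ 2 dvd H" "q dvd H" using H q(3,4) by (simp_all add: coprime_dvd_mult_right_iff)
  hence mq: "multiplicity q H = 1" by (intro multiplicity_eq_1I)
  have H0: "H \<noteq> 0" using \<open>\<not> q ^ 2 dvd H\<close> by auto
  have mqk: "multiplicity q (k ^ degree f) = 0"
    using qk(1) prime_dvd_power[OF q(1)] by (intro not_dvd_imp_multiplicity_0) blast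
  define r :: rat where "r = of_int x / of_int k"
  have fr: "poly (map_poly of_int f) r = of_int H / of_int (k ^ degree f)"
    unfolding r_def H_def by (rule poly_of_int_fraction) (use assms(4) in simp)
  have fr0: "poly (map_poly of_int f) r \<noteq> 0" unfolding fr using H0 assms(4) by simp
  define d where "d = rat_squarefree_part (poly (map_poly of_int f) r)"
  have k0: "k ^ degree f \<noteq> 0" using assms(4) by simp
  have "q dvd d"
    unfolding d_def fr prime_dvd_rat_squarefree_part_iff[OF H0 k0 q(1)] mq mqk by simp
  have "p dvd d"
    unfolding d_def fr prime_dvd_rat_squarefree_part_iff[OF H0 k0 assms(3)]
    using val[OF x(2)] unfolding H_def .
  moreover have "d \<in> squarefree_values f"
    unfolding squarefree_values_def d_def using fr0 by blast
  ultimately have "d \<in> ?D" by simp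
  hence "\<bar>d\<bar> \<le> (\<Sum>d\<in>?D. \<bar>d\<bar>)"
    by (rule member_le_sum[where f = abs, OF _ _ fin]) simp
  moreover have "d \<noteq> 0" unfolding d_def by (rule rat_squarefree_part_nonzero[OF fr0])
  hence "q \<le> \<bar>d\<bar>" using \<open>q dvd d\<close> by (intro zdvd_imp_le) simp_all
  ultimately show False using qgt(3) by linarith
qed

section \<open>Discriminants and simple roots at a good prime\<close>

text \<open>A common root \<open>a\<close> gives the kernel vector of descending powers of \<open>a\<close>, regardless of whether
  the formal degrees are attained.\<close>

lemma resultant_sub_eq_0_of_common_root:
  fixes g h :: "'a::field poly"
  assumes deg: "degree g \<le> m" "degree h \<le> n" and pos: "m + n > 0"
    and root: "poly g a = 0" "poly h a = 0"
  shows "resultant_sub m n g h = 0"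
proof -
  let ?A = "sylvester_mat_sub m n g h"
  let ?v = "vec (m + n) (\<lambda>j. a ^ (m + n - 1 - j))"
  \<comment> \<open>A Sylvester row holds the coefficients of \<open>p\<close>, of formal degree
    \<open>l\<close>, shifted by \<open>b\<close>; its product with the vector is
    \<open>poly p a\<close> times a power of \<open>a\<close>.\<close>
  have shift: "(\<Sum>j = 0..<m + n. (if b \<le> j \<and> j \<le> b + l then coeff p (b + l - j) else 0) * a ^ (m + n - 1 - j)) = 0"
    if "degree p \<le> l" "poly p a = 0" "b + l < m + n" for p b l
  proof -
    have "(\<Sum>j = 0..<m + n. (if b \<le> j \<and> j \<le> b + l then coeff p (b + l - j) else 0) * a ^ (m + n - 1 - j))
        = (\<Sum>j = b..b + l. coeff p (b + l - j) * a ^ (m + n - 1 - j))"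
      using that(3) by (intro sum.mono_neutral_cong_right) auto
    also have "\<dots> = (\<Sum>i\<le>l. coeff p i * a ^ i * a ^ (m + n - 1 - (b + l)))"
      by (rule sum.reindex_bij_witness[of _ "\<lambda>i. b + l - i" "\<lambda>j. b + l - j"])
        (use that(3) in \<open>auto simp: mult.assoc simp flip: power_add\<close>)
    also have "\<dots> = (\<Sum>i\<le>degree p. coeff p i * a ^ i) * a ^ (m + n - 1 - (b + l))"
      unfolding sum_distrib_right using that(1)
      by (intro sum.mono_neutral_right) (auto simp: coeff_eq_0)
    also have "\<dots> = poly p a * a ^ (m + n - 1 - (b + l))"
      by (simp add: poly_altdef)
    finally show ?thesis using that(2) by simp
  qed
  have "?A *\<^sub>v ?v = 0\<^sub>v (m + n)"
  proof (rule eq_vecI)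
    fix i assume "i < dim_vec (0\<^sub>v (m + n) :: 'a vec)"
    hence i: "i < m + n" by simp
    have "(?A *\<^sub>v ?v) $ i = (\<Sum>j = 0..<m + n. ?A $$ (i, j) * a ^ (m + n - 1 - j))"
      using i by (simp add: scalar_prod_def)
    also have "\<dots> = 0"
    proof (cases "i < n")
      case True
      have "?A $$ (i, j) = (if i \<le> j \<and> j \<le> i + m then coeff g (i + m - j) else 0)"
        if "j < m + n" for j
        unfolding sylvester_mat_sub_index[OF i that] using True by (auto simp: add.commute)
      thus ?thesis using shift[OF deg(1) root(1), of i] True by simp
    next
      case False
      have "?A $$ (i, j) = (if i - n \<le> j \<and> j \<le> i - n + n then coeff h (i - n + n - j) else 0)"
        if "j < m + n" for j
        unfolding sylvester_mat_sub_index[OF i that] using False by auto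
      thus ?thesis using shift[OF deg(2) root(2), of "i - n"] False i by simp
    qed
    finally show "(?A *\<^sub>v ?v) $ i = 0\<^sub>v (m + n) $ i" using i by simp
  qed simp
  moreover have "?v \<noteq> 0\<^sub>v (m + n)"
  proof
    assume "?v = 0\<^sub>v (m + n)"
    \<comment> \<open>The last entry is \<open>a ^ 0 = 1\<close>, so the vector is nonzero even for
      \<open>a = 0\<close>.\<close>
    from arg_cong[OF this, of "\<lambda>v :: 'a vec. v $ (m + n - 1)"] show False using pos by simp
  qed
  moreover have "?v \<in> carrier_vec (m + n)" by simp
  ultimately show ?thesis
    unfolding resultant_sub_def det_0_iff_vec_prod_zero[OF sylvester_mat_sub_carrier] by blast
qed

text \<open>The derivative may have degree below \<open>degree g - 1\<close> in positive
  characteristic; the resultant criterion asks only for upper bounds on the degrees.\<close>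

lemma discriminant_eq_0_of_double_root:
  fixes g :: "'a::field poly"
  assumes "degree g > 0" "poly g a = 0" "poly (pderiv g) a = 0"
  shows "discriminant g = 0"
proof -
  have "resultant_sub (degree g) (degree g - 1) g (pderiv g) = 0"
    by (rule resultant_sub_eq_0_of_common_root[where a = a])
      (use assms in \<open>auto intro!: degree_le simp: coeff_pderiv coeff_eq_0\<close>)
  thus ?thesis by (simp add: discriminant_def Let_def)
qed

lemma of_int_mod_ring_eq_0_iff:
  "(of_int x :: 'p::prime_card mod_ring) = 0 \<longleftrightarrow> int (CARD('p)) dvd x"
  by (simp add: of_int_eq_0_iff_char_dvd)

lemma good_prime_lead_coeff:
  assumes "degree f > 0" "good_prime TYPE('p::prime_card) f"
  shows "\<not> int (CARD('p)) dvd lead_coeff f"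
proof
  assume "int (CARD('p)) dvd lead_coeff f"
  hence "coeff (map_poly of_int f :: 'p mod_ring poly) (degree f) = 0"
    by (simp add: coeff_map_poly of_int_mod_ring_eq_0_iff)
  moreover have deg: "degree (map_poly of_int f :: 'p mod_ring poly) = degree f"
    using assms(2) by (simp add: good_prime_def)
  ultimately have "map_poly of_int f = (0 :: 'p mod_ring poly)" by (metis leading_coeff_0_iff)
  thus False using deg assms(1) by simp
qed

text \<open>Otherwise the class of \<open>a\<close> would be a double root of the reduction, and the
  discriminant would vanish.\<close>

lemma good_prime_simple_root:
  assumes "degree f > 0" "good_prime TYPE('p::prime_card) f" "int (CARD('p)) dvd poly f a"
  shows "\<not> int (CARD('p)) dvd poly (pderiv f) a"
proof
  let ?F = "map_poly of_int f :: 'p mod_ring poly"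
  assume d: "int (CARD('p)) dvd poly (pderiv f) a"
  have D: "pderiv ?F = map_poly of_int (pderiv f)"
    by (intro poly_eqI) (simp add: coeff_map_poly coeff_pderiv)
  have P: "poly (map_poly of_int g) (of_int x) = (of_int (poly g x) :: 'p mod_ring)" for g x
    by (induction g) (auto simp: map_poly_pCons)
  have "discriminant ?F = 0"
    by (rule discriminant_eq_0_of_double_root[where a = "of_int a"])
      (use assms d in \<open>auto simp: D P of_int_mod_ring_eq_0_iff good_prime_def\<close>)
  thus False using assms(2) by (simp add: good_prime_def)
qed

section \<open>Even degree: odd valuation forces a root\<close>

text \<open>In even degree the denominator \<open>B ^ n\<close> has even valuation, so
  \<open>p\<close> divides the numerator \<open>H\<close>. If \<open>p\<close> divided
  \<open>B\<close>, the leading term would force it to divide \<open>A\<close> too, against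
  coprimality; so \<open>A / B\<close> reduces to a root modulo \<open>p\<close>.\<close>

lemma has_root_mod_of_prime_dvd_squarefree_value:
  fixes p :: nat
  assumes "prime p" "even (degree f)" "\<not> int p dvd lead_coeff f"
    and d: "d \<in> squarefree_values f" "int p dvd d"
  shows "has_root_mod f p"
proof -
  let ?n = "degree f"
  have pp: "prime (int p)" using assms(1) by simp
  obtain r :: rat where r: "poly (map_poly of_int f) r \<noteq> 0"
      "d = rat_squarefree_part (poly (map_poly of_int f) r)"
    using d(1) by (auto simp: squarefree_values_def)
  obtain A B where q: "quotient_of r = (A, B)" by (cases "quotient_of r")
  have B: "B > 0" using q by (rule quotient_of_denom_pos)
  have rAB: "r = of_int A / of_int B" using q by (rule quotient_of_div)
  have cop: "coprime A B" using q by (rule quotient_of_coprime)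
  define H where "H = homogenization f A B"
  have fr: "poly (map_poly of_int f) r = of_int H / of_int (B ^ ?n)"
    unfolding rAB H_def by (rule poly_of_int_fraction) (use B in auto)
  have H0: "H \<noteq> 0" using r(1) unfolding fr by auto
  have B0: "B ^ ?n \<noteq> 0" using B by simp
  have "odd (multiplicity (int p) H + multiplicity (int p) (B ^ ?n))"
    using d(2) unfolding r(2) fr prime_dvd_rat_squarefree_part_iff[OF H0 B0 pp] .
  moreover have "multiplicity (int p) (B ^ ?n) = ?n * multiplicity (int p) B"
    using B pp by (simp add: prime_elem_multiplicity_power_distrib)
  ultimately have "odd (multiplicity (int p) H)" using assms(2) by simp
  hence pH: "int p dvd H" by (metis even_zero not_dvd_imp_multiplicity_0)
  have pB: "\<not> int p dvd B"
  proof
    assume "int p dvd B"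
    hence "int p dvd lead_coeff f * A ^ ?n"
      using homogenization_cong_lead[of "int p" B f A] pH unfolding H_def by (simp add: cong_dvd_iff)
    hence "int p dvd A" using assms(3) prime_dvd_mult_iff[OF pp] prime_dvd_power[OF pp] by blast
    hence "is_unit (int p)" using coprime_common_divisor[OF cop] \<open>int p dvd B\<close> by blast
    thus False using pp not_prime_unit by blast
  qed
  hence "coprime B (int p)" using prime_imp_coprime[OF pp] by (simp add: coprime_commute)
  \<comment> \<open>\<open>C\<close> inverts \<open>B\<close> modulo \<open>p\<close>, so
    \<open>C * A\<close> is an integer standing for \<open>A / B\<close>.\<close>
  from cong_solve_coprime_int[OF this] obtain C where C: "[B * C = 1] (mod int p)" by blast
  have "[B * (C * A) = A] (mod int p)"
    using cong_mult[OF C cong_refl[of A]] by (simp add: mult.assoc)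
  hence "[homogenization f (B * (C * A)) B = H] (mod int p)"
    unfolding H_def by (rule homogenization_cong)
  hence "int p dvd B ^ ?n * poly f (C * A)"
    using pH unfolding homogenization_scale by (simp add: cong_dvd_iff)
  hence "int p dvd poly f (C * A)" using pB prime_dvd_mult_iff[OF pp] prime_dvd_power[OF pp] by blast
  thus ?thesis unfolding has_root_mod_def cong_0_iff by blast
qed

theorem theorem2p5:
  fixes f :: "int poly" and p :: nat
  assumes "degree f > 0"
    and "separable_int_poly f"
    and "CARD('p::prime_card) = p"
    and "good_prime TYPE('p) f"
  shows "(odd (degree f) \<longrightarrow> infinite {d \<in> squarefree_values f. int p dvd d}) \<and>
    (even (degree f) \<longrightarrow>
       ((\<exists>d \<in> squarefree_values f. int p dvd d) \<longrightarrow> has_root_mod f p) \<and>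
       (has_root_mod f p \<longrightarrow> infinite {d \<in> squarefree_values f. int p dvd d}))"
proof -
  have p: "prime p" using prime_card[where 'a = 'p] assms(3) by simp
  hence pp: "prime (int p)" by simp
  have p0: "int p > 0" using p by (simp add: prime_gt_0_nat)
  have lc: "\<not> int p dvd lead_coeff f"
    using good_prime_lead_coeff[OF assms(1,4)] assms(3) by simp
  have "infinite {d \<in> squarefree_values f. int p dvd d}" if odd: "odd (degree f)"
  \<comment> \<open>The fractions are \<open>x / p\<close> with \<open>x\<close> congruent to 1: the
    numerator is prime to \<open>p\<close>, and the denominator has the odd valuation
    \<open>degree f\<close>.\<close>
  proof (rule infinite_squarefree_values_in_residue_class[OF assms(1,2) pp p0 p0])
    fix x assume x: "[x = 1] (mod int p)"
    have "[homogenization f x (int p) = lead_coeff f * x ^ degree f] (mod int p)"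
      by (rule homogenization_cong_lead) simp
    also have "[lead_coeff f * x ^ degree f = lead_coeff f * 1 ^ degree f] (mod int p)"
      by (intro cong_mult cong_pow cong_refl x)
    finally have "\<not> int p dvd homogenization f x (int p)" using lc by (simp add: cong_dvd_iff)
    moreover have "multiplicity (int p) (int p ^ degree f) = degree f"
      using pp by (intro multiplicity_same_power) auto
    ultimately show "odd (multiplicity (int p) (homogenization f x (int p)) + multiplicity (int p) (int p ^ degree f))"
      using odd by (simp add: not_dvd_imp_multiplicity_0)
  qed
  moreover have "infinite {d \<in> squarefree_values f. int p dvd d}" if root: "has_root_mod f p"
  proof -
    obtain a where a: "int p dvd poly f a" using root by (auto simp: has_root_mod_def cong_0_iff)
    have "\<not> int p dvd poly (pderiv f) a"
      using good_prime_simple_root[OF assms(1,4), of a] a assms(3) by simp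
    then obtain b where b: "int p dvd poly f b" "\<not> int p ^ 2 dvd poly f b"
      using simple_root_mod_exactly_dvd[OF pp a] by blast
    show ?thesis
    \<comment> \<open>Denominator 1 suffices here; the modulus is \<open>p ^ 2\<close> because the
      class of \<open>b\<close> modulo \<open>p ^ 2\<close> fixes the valuation as exactly
      1.\<close>
    proof (rule infinite_squarefree_values_in_residue_class[OF assms(1,2) pp, of 1 "int p ^ 2"])
      fix x assume x: "[x = b] (mod int p ^ 2)"
      have c: "[poly f x = poly f b] (mod int p ^ 2)" using x by (rule poly_int_cong)
      hence "[poly f x = poly f b] (mod int p)" by (rule cong_dvd_modulus) simp
      hence "multiplicity (int p) (poly f x) = 1"
        using b c by (intro multiplicity_eq_1I) (auto simp: cong_dvd_iff)
      thus "odd (multiplicity (int p) (homogenization f x 1) + multiplicity (int p) (1 ^ degree f))"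
        by simp
    qed (use p0 in auto)
  qed
  moreover have "has_root_mod f p"
    if "even (degree f)" "\<exists>d \<in> squarefree_values f. int p dvd d"
    using that has_root_mod_of_prime_dvd_squarefree_value[OF p _ lc] by blast
  ultimately show ?thesis by blast
qed

end
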